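(* Let $p$ be a positive real number, $n$ a positive integer, and $\mu\in W^{n-1,\infty}(\mathbb{D})$ such that $\|\mu\|_{W^{n-1,\infty}(\mathbb{D})}\le c<1$ for some positive real number $c$. Let $w=\sum_{k=0}^{n-1}(z^* )^kw_k$, where each $w_k:\mathbb{D}\to\mathbb{C}$ solves $\frac{\partial w_k}{\partial z^*}=\mu\frac{\partial w_k}{\partial z}$. Then $w\in H^{n,p}_{Bel,\mu}(\mathbb{D})$ if and only if $w_k\in H^p_{Bel,\mu}(\mathbb{D})$ for $0\le k\le n-1$.
   Context: $\mathbb{D}$ is the unit disk in $\mathbb{C}$, $z=x+iy$; $z^*=x-iy$ denotes complex conjugation; $\frac{\partial}{\partial z}=\frac12(\partial_x-i\partial_y)$, $\frac{\partial}{\partial z^*}=\frac12(\partial_x+i\partial_y)$. $W^{k,\infty}(\mathbb{D})$ is the Sobolev space of complex-valued functions that along with their derivatives up to order $k$ are in $L^\infty(\mathbb{D})$. $H^p_{Bel,\mu}(\mathbb{D})$ is the set of $v:\mathbb{D}\to\mathbb{C}$ that solve $\frac{\partial v}{\partial z^*}=\mu\frac{\partial v}{\partial z}$ and satisfy $\sup_{0<r<1}\int_0^{2\pi}|v(re^{i\theta})|^p\,d\theta<\infty$. $H^{n,p}_{Bel,\mu}(\mathbb{D})$ is the set of $w:\mathbb{D}\to\mathbb{C}$ that solve $\left(\frac{\partial}{\partial z^*}-\mu\frac{\partial}{\partial z}\right)^nw=0$ (the power denoting iteration) and satisfy $$\sum_{k=0}^{n-1}\sup_{0<r<1}\int_0^{2\pi}\left|\left(\frac{\partial}{\partial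 z^*}-\mu\frac{\partial}{\partial z}\right)^kw(re^{i\theta})\right|^p\,d\theta<\infty.$$ Solutions of the $n$-th order equation are representable in the form $\sum_{k=0}^{n-1}(z^* )^kw_k$ with $w_k$ as in the claim; this is the representation meant. *)

theory Defs
  imports "HOL-Probability.Essential_Supremum"
begin

text \<open>
  Functions on the unit disc are total functions on the complex plane; only their values on
  the disc matter. The plane is treated as a real two-dimensional space: \<^term>\<open>f differentiable at z\<close>
  is real differentiability, and a derivative in direction \<^term>\<open>1\<close> or \<^term>\<open>\<i>\<close> is a
  partial derivative in \<open>x\<close> or \<open>y\<close>.
\<close>

abbreviation disc :: "complex set" where
  "disc \<equiv> ball 0 1"

definition pdx :: "(complex \<Rightarrow> complex) \<Rightarrow> complex \<Rightarrow> complex" where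
  "pdx f z = frechet_derivative f (at z) 1"

definition pdy :: "(complex \<Rightarrow> complex) \<Rightarrow> complex \<Rightarrow> complex" where
  "pdy f z = frechet_derivative f (at z) \<i>"

primrec Ck :: "nat \<Rightarrow> (complex \<Rightarrow> complex) \<Rightarrow> bool" where
  "Ck 0 f \<longleftrightarrow> continuous_on UNIV f"
| "Ck (Suc k) f \<longleftrightarrow> (\<forall>z. f differentiable at z) \<and> Ck k (pdx f) \<and> Ck k (pdy f)"

definition test_fun :: "(complex \<Rightarrow> complex) \<Rightarrow> bool" where
  "test_fun \<phi> \<longleftrightarrow>
     (\<forall>k. Ck k \<phi>) \<and> (\<exists>K. compact K \<and> K \<subseteq> disc \<and> (\<forall>z. z \<notin> K \<longrightarrow> \<phi> z = 0))"

definition L1_loc :: "(complex \<Rightarrow> complex) \<Rightarrow> bool" where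
  "L1_loc f \<longleftrightarrow> (\<forall>K. compact K \<and> K \<subseteq> disc \<longrightarrow> set_integrable lebesgue K f)"

definition L2_loc :: "(complex \<Rightarrow> complex) \<Rightarrow> bool" where
  "L2_loc f \<longleftrightarrow> f \<in> borel_measurable (lebesgue_on disc) \<and>
     (\<forall>K. compact K \<and> K \<subseteq> disc \<longrightarrow> set_integrable lebesgue K (\<lambda>z. (cmod (f z))\<^sup>2))"

text \<open>The distributional derivative of order \<open>a\<close> in \<open>x\<close> and \<open>b\<close> in \<open>y\<close>, as a locally integrable function.\<close>

definition has_weak_pderiv :: "nat \<Rightarrow> nat \<Rightarrow> (complex \<Rightarrow> complex) \<Rightarrow> (complex \<Rightarrow> complex) \<Rightarrow> bool" where
  "has_weak_pderiv a b u g \<longleftrightarrow> L1_loc u \<and> L1_loc g \<and>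
     (\<forall>\<phi>. test_fun \<phi> \<longrightarrow>
        (LINT z|lebesgue_on disc. u z * (pdx ^^ a) ((pdy ^^ b) \<phi>) z)
          = (-1) ^ (a + b) * (LINT z|lebesgue_on disc. g z * \<phi> z))"

definition Linf_norm :: "(complex \<Rightarrow> complex) \<Rightarrow> ereal" where
  "Linf_norm f = esssup (lebesgue_on disc) (\<lambda>z. ereal (cmod (f z)))"

definition W_inf :: "nat \<Rightarrow> (complex \<Rightarrow> complex) set" where
  "W_inf k = {u. \<forall>a b. a + b \<le> k \<longrightarrow> (\<exists>g. has_weak_pderiv a b u g \<and> Linf_norm g < \<infinity>)}"

text \<open>
  The Sobolev norm is the largest sup norm among all derivatives of order at most \<open>k\<close>. A weak
  derivative is unique up to a null set, so the choice made by \<open>weak_pderiv\<close> does not affect it.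
\<close>

definition weak_pderiv :: "nat \<Rightarrow> nat \<Rightarrow> (complex \<Rightarrow> complex) \<Rightarrow> complex \<Rightarrow> complex" where
  "weak_pderiv a b u = (SOME g. has_weak_pderiv a b u g)"

definition W_inf_norm :: "nat \<Rightarrow> (complex \<Rightarrow> complex) \<Rightarrow> ereal" where
  "W_inf_norm k u = (SUP (a, b)\<in>{(a, b). a + b \<le> k}. Linf_norm (weak_pderiv a b u))"

text \<open>
  \<open>bel_op \<mu> u f\<close> says that \<open>u\<close> is in local \<open>W\<^sup>1\<^sup>,\<^sup>2\<close> of the disc and that its image under the
  operator \<open>\<partial>/\<partial>z\<^sup>* - \<mu> \<partial>/\<partial>z\<close> is \<open>f\<close>. It is a relation because the image is determined only almost
  everywhere. Integrals over circles need pointwise values, so both \<open>u\<close> and \<open>f\<close> are required to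
  be the continuous representatives; these are unique on the disc, and they exist for
  solutions of the Beltrami equation by the regularity theory of quasiregular maps.
\<close>

definition bel_op :: "(complex \<Rightarrow> complex) \<Rightarrow> (complex \<Rightarrow> complex) \<Rightarrow> (complex \<Rightarrow> complex) \<Rightarrow> bool" where
  "bel_op \<mu> u f \<longleftrightarrow> continuous_on disc u \<and> continuous_on disc f \<and>
     (\<exists>ux uy. has_weak_pderiv 1 0 u ux \<and> has_weak_pderiv 0 1 u uy \<and> L2_loc ux \<and> L2_loc uy \<and>
        (AE z in lebesgue_on disc.
           f z = (ux z + \<i> * uy z) / 2 - \<mu> z * ((ux z - \<i> * uy z) / 2)))"

definition solves_beltrami :: "(complex \<Rightarrow> complex) \<Rightarrow> (complex \<Rightarrow> complex) \<Rightarrow> bool" where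
  "solves_beltrami \<mu> v \<longleftrightarrow> bel_op \<mu> v (\<lambda>_. 0)"

definition circle_sup :: "real \<Rightarrow> (complex \<Rightarrow> complex) \<Rightarrow> ennreal" where
  "circle_sup p v =
     (SUP r\<in>{0<..<1}. \<integral>\<^sup>+\<theta>\<in>{0..2 * pi}. ennreal (cmod (v (rcis r \<theta>)) powr p) \<partial>lborel)"

definition H_Bel :: "real \<Rightarrow> (complex \<Rightarrow> complex) \<Rightarrow> (complex \<Rightarrow> complex) set" where
  "H_Bel p \<mu> = {v. solves_beltrami \<mu> v \<and> circle_sup p v < \<infinity>}"

text \<open>In \<open>Hn_Bel\<close>, \<open>g k\<close> is the image of \<open>w\<close> under the \<open>k\<close>-th iterate of the operator.\<close>

definition Hn_Bel :: "nat \<Rightarrow> real \<Rightarrow> (complex \<Rightarrow> complex) \<Rightarrow> (complex \<Rightarrow> complex) set" where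
  "Hn_Bel n p \<mu> = {w. \<exists>g. g 0 = w \<and> (\<forall>k<n. bel_op \<mu> (g k) (g (Suc k))) \<and>
     (\<forall>z\<in>disc. g n z = 0) \<and> (\<Sum>k<n. circle_sup p (g k)) < \<infinity>}"

end

theory Submission
  imports Defs
begin

text \<open>
  Write \<open>B\<close> for the operator \<open>\<partial>/\<partial>z\<^sup>* - \<mu> \<partial>/\<partial>z\<close>. Since \<open>B z\<^sup>* = 1\<close> and \<open>B w\<^sub>k = 0\<close>, the
  product rule gives \<open>B ((z\<^sup>*)\<^sup>m w\<^sub>k) = m (z\<^sup>*)\<^bsup>m-1\<^esup> w\<^sub>k\<close>, so the \<open>j\<close>-th iterate of \<open>w\<close> is the sum of
  \<open>k(k-1)\<dots>(k-j+1) (z\<^sup>*)\<^bsup>k-j\<^esup> w\<^sub>k\<close> over \<open>j \<le> k < n\<close>. This is a triangular system with bounded coefficients and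
  nonzero constants on the diagonal: it bounds the circle means of the iterates by those of the
  \<open>w\<^sub>k\<close>, and solving it from \<open>k = n - 1\<close> downwards gives the converse. The converse also needs
  that the iterates are unique, i.e. that weak derivatives are determined almost everywhere;
  this follows by approximating indicators of boxes by test functions built from \<open>exp (-1/x)\<close>.
\<close>

section \<open>Smooth functions and bumps on boxes\<close>

lemma pdx_eq: "(f has_derivative f') (at z) \<Longrightarrow> pdx f z = f' 1"
  and pdy_eq: "(f has_derivative f') (at z) \<Longrightarrow> pdy f z = f' \<i>"
  unfolding pdx_def pdy_def by (metis frechet_derivative_at)+

lemma Ck_Suc_imp: "Ck (Suc k) f \<Longrightarrow> Ck k f"
proof (induction k arbitrary: f)
  case 0
  then show ?case
    by (auto simp: continuous_on_eq_continuous_at intro: differentiable_imp_continuous_within)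
next
  case (Suc k)
  then show ?case by (metis Ck.simps(2))
qed

lemma Ck_const: "Ck k (\<lambda>_. c)"
proof (induction k arbitrary: c)
  case (Suc k)
  have "pdx (\<lambda>_. c) = (\<lambda>_. 0)" "pdy (\<lambda>_. c) = (\<lambda>_. 0)"
    by (auto simp: pdx_def pdy_def)
  with Suc show ?case by simp
qed simp

lemma
  assumes "f differentiable at z" "g differentiable at z"
  shows pdx_add: "pdx (\<lambda>z. f z + g z) z = pdx f z + pdx g z"
    and pdy_add: "pdy (\<lambda>z. f z + g z) z = pdy f z + pdy g z"
    and pdx_mult: "pdx (\<lambda>z. f z * g z) z = f z * pdx g z + pdx f z * g z"
    and pdy_mult: "pdy (\<lambda>z. f z * g z) z = f z * pdy g z + pdy f z * g z"
proof -
  note fg = assms[unfolded frechet_derivative_works]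
  show "pdx (\<lambda>z. f z + g z) z = pdx f z + pdx g z" "pdy (\<lambda>z. f z + g z) z = pdy f z + pdy g z"
    using pdx_eq[OF has_derivative_add[OF fg]] pdy_eq[OF has_derivative_add[OF fg]]
    by (simp_all add: pdx_def pdy_def)
  show "pdx (\<lambda>z. f z * g z) z = f z * pdx g z + pdx f z * g z"
    "pdy (\<lambda>z. f z * g z) z = f z * pdy g z + pdy f z * g z"
    using pdx_eq[OF has_derivative_mult[OF fg]] pdy_eq[OF has_derivative_mult[OF fg]]
    by (simp_all add: pdx_def pdy_def)
qed

lemma Ck_add: "Ck k f \<Longrightarrow> Ck k g \<Longrightarrow> Ck k (\<lambda>z. f z + g z)"
proof (induction k arbitrary: f g)
  case (Suc k)
  then have d: "f differentiable at z" "g differentiable at z" for z by auto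
  have "pdx (\<lambda>z. f z + g z) = (\<lambda>z. pdx f z + pdx g z)"
    "pdy (\<lambda>z. f z + g z) = (\<lambda>z. pdy f z + pdy g z)"
    by (intro ext pdx_add pdy_add d)+
  with Suc d show ?case by auto
qed (auto intro!: continuous_intros)

lemma Ck_mult: "Ck k f \<Longrightarrow> Ck k g \<Longrightarrow> Ck k (\<lambda>z. f z * g z)"
proof (induction k arbitrary: f g)
  case (Suc k)
  then have d: "f differentiable at z" "g differentiable at z" for z by auto
  have "pdx (\<lambda>z. f z * g z) = (\<lambda>z. f z * pdx g z + pdx f z * g z)"
    "pdy (\<lambda>z. f z * g z) = (\<lambda>z. f z * pdy g z + pdy f z * g z)"
    by (intro ext pdx_mult pdy_mult d)+
  \<comment> \<open>The product rule leaves one factor undifferentiated, so \<open>f\<close> and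
    \<open>g\<close> themselves are needed at the lower order \<open>k\<close>.\<close>
  moreover have "Ck k f" "Ck k g" using Suc.prems Ck_Suc_imp by blast+
  ultimately show ?case using Suc d by (auto intro!: Ck_add)
qed (auto intro!: continuous_intros)

text \<open>The map \<open>cnj\<close> is real linear with \<open>cnj 1 = 1\<close> and
  \<open>cnj \<i> = - \<i>\<close>, whence the factor \<open>- \<i>\<close> in the second formula.
  For \<open>m = 0\<close> the truncated exponent \<open>m - 1\<close> is harmless because
  \<open>of_nat m\<close> vanishes.\<close>

lemma
  shows pdx_cnj_power: "pdx (\<lambda>z. a * cnj z ^ m) z = a * (of_nat m * cnj z ^ (m - 1))"
    and pdy_cnj_power: "pdy (\<lambda>z. a * cnj z ^ m) z = - \<i> * (a * (of_nat m * cnj z ^ (m - 1)))"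
proof -
  have D: "((\<lambda>z. a * cnj z ^ m) has_derivative
      (\<lambda>h. a * (of_nat m * cnj h * cnj z ^ (m - 1)))) (at z)"
    by (auto intro!: derivative_eq_intros)
  show "pdx (\<lambda>z. a * cnj z ^ m) z = a * (of_nat m * cnj z ^ (m - 1))"
    "pdy (\<lambda>z. a * cnj z ^ m) z = - \<i> * (a * (of_nat m * cnj z ^ (m - 1)))"
    using pdx_eq[OF D] pdy_eq[OF D] by simp_all
qed

text \<open>Both partial derivatives are again a constant times a power of \<open>cnj z\<close>;
  keeping \<open>a\<close> and \<open>m\<close> arbitrary lets the induction close.\<close>

lemma Ck_cnj_power: "Ck k (\<lambda>z. a * cnj z ^ m)"
proof (induction k arbitrary: a m)
  case (Suc k)
  have "pdx (\<lambda>z. a * cnj z ^ m) = (\<lambda>z. (a * of_nat m) * cnj z ^ (m - 1))"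
    "pdy (\<lambda>z. a * cnj z ^ m) = (\<lambda>z. (- \<i> * a * of_nat m) * cnj z ^ (m - 1))"
    by (intro ext, simp add: pdx_cnj_power pdy_cnj_power)+
  moreover have "(\<lambda>z. a * cnj z ^ m) differentiable at z" for z
    unfolding differentiable_def by (rule exI) (auto intro!: derivative_eq_intros)
  ultimately show ?case
    using Suc[of "a * of_nat m" "m - 1"] Suc[of "- \<i> * a * of_nat m" "m - 1"]
    by (simp del: mult_minus_left)
qed (auto intro!: continuous_intros)

text \<open>The case \<open>k = 0\<close> is the classical smooth flat function exp (-1/x). The
  powers of 1/x are those produced by differentiating it, so the span of the family is closed under
  derivatives.\<close>

definition flat :: "nat \<Rightarrow> real \<Rightarrow> real" where
  "flat k x = (if x > 0 then inverse x ^ k * exp (- inverse x) else 0)"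

text \<open>On the right, substituting t = 1/x reduces the claim to the fact that exp t outgrows
  every power of t.\<close>

lemma flat_tendsto_0: "(flat k \<longlongrightarrow> 0) (at 0)"
proof -
  have "((\<lambda>x::real. inverse x ^ k / exp (inverse x)) \<longlongrightarrow> 0) (at_right 0)"
    by (rule filterlim_compose[OF tendsto_power_div_exp_0 filterlim_inverse_at_top_right])
  then have "(flat k \<longlongrightarrow> 0) (at_right 0)"
    by (rule Lim_transform_eventually)
      (auto simp: flat_def exp_minus field_simps eventually_at_filter)
  moreover have "(flat k \<longlongrightarrow> 0) (at_left 0)"
    by (rule Lim_transform_eventually[OF tendsto_const])
      (auto simp: flat_def eventually_at_filter)
  ultimately show ?thesis by (simp add: filterlim_split_at)
qed

lemma flat_deriv:
  "(flat k has_real_derivative flat (k + 2) x - real k * flat (k + 1) x) (at x)"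
proof -
  consider "x > 0" | "x < 0" | "x = 0" by linarith
  then show ?thesis
  proof cases
    case 1
    have "((\<lambda>x. inverse x ^ k * exp (- inverse x)) has_real_derivative
        real k * inverse x ^ (k - 1) * (- (inverse x * inverse x)) * exp (- inverse x) +
        inverse x ^ k * (exp (- inverse x) * (inverse x * inverse x))) (at x)"
      using 1 by (auto intro!: derivative_eq_intros)
    also have "real k * inverse x ^ (k - 1) * (- (inverse x * inverse x)) * exp (- inverse x) +
        inverse x ^ k * (exp (- inverse x) * (inverse x * inverse x)) =
        flat (k + 2) x - real k * flat (k + 1) x"
      using 1 by (cases k) (simp_all add: flat_def algebra_simps)
    finally have "((\<lambda>x. inverse x ^ k * exp (- inverse x)) has_real_derivative
        flat (k + 2) x - real k * flat (k + 1) x) (at x)" .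
    then show ?thesis
      by (rule has_field_derivative_transform_within_open[of _ _ _ "{0<..}"])
        (use 1 in \<open>auto simp: flat_def\<close>)
  next
    case 2
    have "((\<lambda>x. 0) has_real_derivative flat (k + 2) x - real k * flat (k + 1) x) (at x)"
      using 2 by (simp add: flat_def)
    then show ?thesis
      by (rule has_field_derivative_transform_within_open[of _ _ _ "{..<0}"])
        (use 2 in \<open>auto simp: flat_def\<close>)
  next
    case 3
    \<comment> \<open>The difference quotient of \<open>flat k\<close> at 0 is itself a member of
      the family, also at \<open>h = 0\<close>, where division by zero gives 0. Its limit is
      therefore already known.\<close>
    have "flat (k + 1) = (\<lambda>h. (flat k (0 + h) - flat k 0) / h)"
      by (auto simp: flat_def fun_eq_iff field_simps)
    with flat_tendsto_0[of "k + 1"] have "((\<lambda>h. (flat k (0 + h) - flat k 0) / h) \<longlongrightarrow> 0) (at 0)"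
      by simp
    then show ?thesis
      unfolding DERIV_def 3 by (simp add: flat_def)
  qed
qed

text \<open>The chain rule turns a partial derivative into a combination of
  \<open>flat (k + 2)\<close> and \<open>flat (k + 1)\<close> at the same affine argument, so the
  induction on the order runs over all \<open>k\<close> at once.\<close>

lemma Ck_flat: "Ck j (\<lambda>z. complex_of_real (flat k (d \<bullet> z + c)))"
proof (induction j arbitrary: k)
  case 0
  have "continuous_on UNIV (flat k)"
    by (meson DERIV_continuous_on flat_deriv has_field_derivative_at_within)
  then show ?case
    by (auto intro!: continuous_intros continuous_on_compose2[of UNIV "flat k"])
next
  case (Suc j)
  let ?D = "\<lambda>z. flat (k + 2) (d \<bullet> z + c) - real k * flat (k + 1) (d \<bullet> z + c)"
  have D: "((\<lambda>z. complex_of_real (flat k (d \<bullet> z + c))) has_derivative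
      (\<lambda>h. complex_of_real (?D z * (d \<bullet> h)))) (at z)" for z
    by (rule derivative_eq_intros has_derivative_compose[OF _ flat_deriv[THEN has_field_derivative_imp_has_derivative]] refl)+
      simp
  let ?E = "\<lambda>e z. complex_of_real (d \<bullet> e) * complex_of_real (flat (k + 2) (d \<bullet> z + c)) +
    complex_of_real (- real k * (d \<bullet> e)) * complex_of_real (flat (k + 1) (d \<bullet> z + c))"
  have E: "Ck j (?E 1)" "Ck j (?E \<i>)"
    by (intro Ck_add Ck_mult Ck_const Suc)+
  have P: "pdx (\<lambda>z. complex_of_real (flat k (d \<bullet> z + c))) = ?E 1"
    "pdy (\<lambda>z. complex_of_real (flat k (d \<bullet> z + c))) = ?E \<i>"
    by (intro ext, subst pdx_eq[OF D] pdy_eq[OF D], simp add: algebra_simps)+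
  show ?case
    unfolding Ck.simps P by (intro conjI allI E) (use D in \<open>auto simp only: differentiable_def\<close>)
qed

text \<open>
  Each factor is \<open>exp (-1 / (m t))\<close> in the signed distance \<open>t\<close> to one side of the box, so the bumps
  increase to the indicator of the open box. The distances are written as inner products to
  match \<open>Ck_flat\<close>.
\<close>

definition box_bump :: "complex \<Rightarrow> complex \<Rightarrow> nat \<Rightarrow> complex \<Rightarrow> complex" where
  "box_bump a b m z = of_real (flat 0 ((of_nat m * 1) \<bullet> z + (- real m * Re a))) *
     of_real (flat 0 ((of_nat m * \<i>) \<bullet> z + (- real m * Im a))) *
     of_real (flat 0 ((- of_nat m * 1) \<bullet> z + (real m * Re b))) *
     of_real (flat 0 ((- of_nat m * \<i>) \<bullet> z + (real m * Im b)))"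

lemma Ck_box_bump: "Ck k (box_bump a b m)"
  unfolding box_bump_def[abs_def] by (intro Ck_mult Ck_flat)

lemma box_bump_eq:
  "box_bump a b m z = of_real (flat 0 (real m * (Re z - Re a))) *
     of_real (flat 0 (real m * (Im z - Im a))) *
     of_real (flat 0 (real m * (Re b - Re z))) *
     of_real (flat 0 (real m * (Im b - Im z)))"
  by (simp add: box_bump_def inner_complex_def algebra_simps)

lemma flat_nonpos: "x \<le> 0 \<Longrightarrow> flat k x = 0"
  by (simp add: flat_def)

lemma box_bump_outside: "z \<notin> box a b \<Longrightarrow> box_bump a b m z = 0"
proof -
  assume "z \<notin> box a b"
  then consider "Re z - Re a \<le> 0" | "Re b - Re z \<le> 0" | "Im z - Im a \<le> 0" | "Im b - Im z \<le> 0"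
    by (force simp: in_box_complex_iff)
  then show ?thesis
    by cases (simp_all add: box_bump_eq flat_nonpos mult_nonneg_nonpos)
qed

lemma flat_0_bounds: "0 \<le> flat 0 x" "flat 0 x \<le> 1"
  by (auto simp: flat_def)

lemma norm_box_bump: "norm (box_bump a b m z) \<le> 1"
  unfolding box_bump_def norm_mult norm_of_real
  by (intro mult_le_one mult_nonneg_nonneg) (auto simp: flat_0_bounds abs_of_nonneg)

lemma flat_0_lim: "t > 0 \<Longrightarrow> (\<lambda>m. flat 0 (real m * t)) \<longlonglongrightarrow> 1"
proof -
  assume t: "t > 0"
  have "(\<lambda>m. exp (- (inverse (real m) * inverse t))) \<longlonglongrightarrow> exp (- (0 * inverse t))"
    by (intro tendsto_intros lim_inverse_n)
  then have "(\<lambda>m. exp (- (inverse (real m) * inverse t))) \<longlonglongrightarrow> 1" by simp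
  then show ?thesis
  proof (rule Lim_transform_eventually)
    show "\<forall>\<^sub>F m in sequentially. exp (- (inverse (real m) * inverse t)) = flat 0 (real m * t)"
      \<comment> \<open>The index 0 must be left out: there \<open>flat 0\<close> is 0, while the
        exponential is 1 because \<open>inverse 0 = 0\<close>.\<close>
      using eventually_gt_at_top[of 0] by eventually_elim (use t in \<open>auto simp: flat_def\<close>)
  qed
qed

lemma box_bump_lim: "(\<lambda>m. box_bump a b m z) \<longlonglongrightarrow> indicator (box a b) z"
proof (cases "z \<in> box a b")
  case True
  then have z: "Re z - Re a > 0" "Re b - Re z > 0" "Im z - Im a > 0" "Im b - Im z > 0"
    by (auto simp: in_box_complex_iff)
  have "(\<lambda>m. complex_of_real (flat 0 (real m * (Re z - Re a))) *
      of_real (flat 0 (real m * (Im z - Im a))) *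
      of_real (flat 0 (real m * (Re b - Re z))) *
      of_real (flat 0 (real m * (Im b - Im z)))) \<longlonglongrightarrow> of_real 1 * of_real 1 * of_real 1 * of_real 1"
    by (intro tendsto_intros flat_0_lim z)
  then show ?thesis using True by (simp add: box_bump_eq)
qed (simp add: box_bump_outside)

lemma test_fun_box_bump: "cbox a b \<subseteq> disc \<Longrightarrow> test_fun (box_bump a b m)"
  unfolding test_fun_def using box_subset_cbox[of a b]
  by (intro conjI allI exI[of _ "cbox a b"]) (auto intro!: Ck_box_bump box_bump_outside)

section \<open>Uniqueness of weak derivatives\<close>

text \<open>Open boxes form an intersection-stable generator of the Borel sets, so a Dynkin argument
  spreads the vanishing of the integral from boxes to Borel sets, and null sets carry it to Lebesgue
  sets. An integrable function whose integral over every measurable set is zero vanishes almost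
  everywhere.\<close>

lemma AE_zero_if_box_integrals_zero:
  fixes H :: "'a::euclidean_space \<Rightarrow> 'b::{banach, second_countable_topology}"
  assumes H: "integrable lebesgue H"
    and box: "\<And>a b. (LINT z:box a b|lebesgue. H z) = 0"
    and total: "(LINT z|lebesgue. H z) = 0"
  shows "AE z in lebesgue. H z = 0"
proof (rule sigma_finite_measure.density_zero[OF _ H])
  show "sigma_finite_measure (lebesgue :: 'a measure)"
  proof
    obtain F :: "'a set set" where "countable F" "F \<subseteq> sets lborel" "\<Union>F = space lborel"
      "\<forall>A\<in>F. emeasure lborel A \<noteq> \<infinity>"
      using lborel.sigma_finite_countable by blast
    then show "\<exists>F. countable F \<and> F \<subseteq> sets (lebesgue :: 'a measure) \<and> \<Union>F = space lebesgue \<and>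
        (\<forall>A\<in>F. emeasure lebesgue A \<noteq> \<infinity>)"
      by (intro exI[of _ F]) (auto simp: subset_iff)
  qed
  let ?G = "range (\<lambda>(a, b). box a b :: 'a set)"
  have G: "sets borel = sigma_sets UNIV ?G"
    by (subst borel_eq_box) simp
  have int: "set_integrable lebesgue A H" if "A \<in> sets lebesgue" for A
    using integrable_mult_indicator[OF that H] by (simp add: set_integrable_def)
  have borel: "(LINT z:A|lebesgue. H z) = 0" if A: "A \<in> sets borel" for A
  proof -
    have "Int_stable ?G"
      by (rule Int_stableI) (force simp: box_Int_box)
    moreover have "?G \<subseteq> Pow UNIV" by simp
    moreover have "A \<in> sigma_sets UNIV ?G" using A G by simp
    ultimately show ?thesis
    proof (induction rule: sigma_sets_induct_disjoint)
      case (basic A)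
      then show ?case using box by auto
    next
      case empty
      then show ?case by (simp add: set_lebesgue_integral_def)
    next
      \<comment> \<open>The whole space is not a box; \<open>total\<close> supplies its integral,
        from which that over the complement follows.\<close>
      case (compl A)
      then have "A \<in> sets borel" using G by simp
      then have A: "A \<in> sets lebesgue" "UNIV - A \<in> sets lebesgue"
        by (auto simp: Compl_eq_Diff_UNIV[symmetric])
      have "(LINT z:A \<union> (UNIV - A)|lebesgue. H z) =
          (LINT z:A|lebesgue. H z) + (LINT z:UNIV - A|lebesgue. H z)"
        by (rule set_integral_Un) (use A int in auto)
      then show ?case using total compl by (simp add: set_lebesgue_integral_def)
    next
      case (union A)
      then have "A i \<in> sets borel" for i using G by auto
      then have A: "A i \<in> sets lebesgue" for i by simp
      have "(LINT z:(\<Union>i. A i)|lebesgue. H z) = (\<Sum>i. LINT z:A i|lebesgue. H z)"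
        using A union by (intro lebesgue_integral_countable_add int)
          (auto simp: disjoint_family_on_def)
      then show ?case using union by simp
    qed
  qed
  fix A :: "'a set" assume A: "A \<in> sets lebesgue"
  \<comment> \<open>A Lebesgue set differs from a Borel set \<open>S\<close> only inside a Borel
    null set, so both give the same integral.\<close>
  then obtain S N N' where S: "A = S \<union> N" "N \<subseteq> N'" "N' \<in> null_sets lborel" "S \<in> sets lborel"
    by (elim sets_completionE) auto
  have "AE x in lborel. x \<notin> N'" using S by (simp add: AE_not_in)
  then have "AE x in lebesgue. x \<notin> N'" by (rule AE_completion)
  then have "AE x in lebesgue. (x \<in> A) = (x \<in> S)"
    by eventually_elim (use S in auto)
  then have "(LINT z:A|lebesgue. H z) = (LINT z:S|lebesgue. H z)"
    by (intro set_integral_cong_set)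
      (use A S H in \<open>auto simp: set_borel_measurable_def intro!: borel_measurable_scaleR borel_measurable_indicator\<close>)
  then show "(LINT z:A|lebesgue. H z) = 0" using borel S by simp
qed

text \<open>The bumps are admissible test functions, are bounded by 1 and converge pointwise to the
  indicator of the box. Dominated convergence, with the modulus of \<open>h\<close> cut off to the
  box as majorant, passes from test functions to the indicator.\<close>

lemma integral_box_zero:
  assumes h: "L1_loc h" and ab: "cbox a b \<subseteq> disc"
    and test: "\<And>\<phi>. test_fun \<phi> \<Longrightarrow> (LINT z|lebesgue_on disc. h z * \<phi> z) = 0"
  shows "(LINT z:box a b|lebesgue. h z) = 0"
proof -
  have "compact (cbox a b)" by simp
  with h ab have "set_integrable lebesgue (cbox a b) h"
    unfolding L1_loc_def by blast
  then have int: "set_integrable lebesgue (box a b) h"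
    by (rule set_integrable_subset) (auto simp: box_subset_cbox)
  then have int': "integrable lebesgue (\<lambda>z. indicator (box a b) z *\<^sub>R h z)"
    by (simp add: set_integrable_def)
  let ?f = "\<lambda>m z. (indicator (box a b) z *\<^sub>R h z) * box_bump a b m z"
  have "(\<lambda>m. LINT z|lebesgue. ?f m z) \<longlonglongrightarrow>
      (LINT z|lebesgue. indicator (box a b) z *\<^sub>R h z)"
  proof (rule integral_dominated_convergence)
    show "integrable lebesgue (\<lambda>z. norm (indicator (box a b) z *\<^sub>R h z))"
      using int' by (rule integrable_norm)
    show "(\<lambda>z. indicator (box a b) z *\<^sub>R h z) \<in> borel_measurable lebesgue"
      using int' by auto
    have "box_bump a b m \<in> borel_measurable borel" for m
      using Ck_box_bump[of 0 a b m] by (auto intro: borel_measurable_continuous_onI)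
    then have "box_bump a b m \<in> borel_measurable lebesgue" for m
      by (simp add: measurable_completion)
    then show "?f m \<in> borel_measurable lebesgue" for m
      using int' by (intro borel_measurable_times) auto
    show "AE z in lebesgue. (\<lambda>m. ?f m z) \<longlonglongrightarrow> indicator (box a b) z *\<^sub>R h z"
    proof (intro AE_I2)
      fix z
      have "(\<lambda>m. ?f m z) \<longlonglongrightarrow> (indicator (box a b) z *\<^sub>R h z) * indicator (box a b) z"
        by (intro tendsto_intros box_bump_lim)
      then show "(\<lambda>m. ?f m z) \<longlonglongrightarrow> indicator (box a b) z *\<^sub>R h z"
        by (simp split: split_indicator_asm split_indicator)
    qed
    show "AE z in lebesgue. norm (?f m z) \<le> norm (indicator (box a b) z *\<^sub>R h z)" for m
      by (intro AE_I2) (simp only: norm_mult mult_left_le norm_box_bump norm_ge_zero)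
  qed
  moreover have "(LINT z|lebesgue. ?f m z) = 0" for m
  proof -
    have "?f m = (\<lambda>z. indicator disc z *\<^sub>R (h z * box_bump a b m z))"
      using ab box_subset_cbox[of a b]
      by (auto simp: fun_eq_iff box_bump_outside split: split_indicator)
    then have "(LINT z|lebesgue. ?f m z) = (LINT z|lebesgue_on disc. h z * box_bump a b m z)"
      by (simp add: integral_restrict_space)
    then show ?thesis using test[OF test_fun_box_bump[OF ab]] by simp
  qed
  ultimately show ?thesis
    by (simp add: set_lebesgue_integral_def LIMSEQ_const_iff)
qed

text \<open>Only local integrability is available, so \<open>h\<close> is first cut off to a box
  whose closure lies in the disc; there the box criterion applies. Countably many such boxes then
  exhaust the disc.\<close>

lemma fundamental_lemma:
  assumes h: "L1_loc h"
    and test: "\<And>\<phi>. test_fun \<phi> \<Longrightarrow> (LINT z|lebesgue_on disc. h z * \<phi> z) = 0"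
  shows "AE z in lebesgue_on disc. h z = 0"
proof -
  have box: "AE z in lebesgue. z \<in> box a b \<longrightarrow> h z = 0" if ab: "cbox a b \<subseteq> disc" for a b
  proof -
    let ?H = "\<lambda>z. indicator (box a b) z *\<^sub>R h z"
    have sub: "(LINT z:box c d|lebesgue. ?H z) = 0" for c d
    proof -
      obtain u v where uv: "box a b \<inter> box c d = box u v" using box_Int_box by blast
      have eq: "(LINT z:box c d|lebesgue. ?H z) = (LINT z:box u v|lebesgue. h z)"
        unfolding set_lebesgue_integral_def uv[symmetric]
        by (intro Bochner_Integration.integral_cong) (auto split: split_indicator)
      \<comment> \<open>The identity closure (box) = cbox holds only for nonempty boxes: an empty
        open box may have a nonempty degenerate closed box, possibly outside the disc.\<close>
      show ?thesis
      proof (cases "box u v = {}")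
        case False
        then have "cbox u v = closure (box u v)" by (simp add: closure_box)
        also have "\<dots> \<subseteq> cbox a b"
          using uv box_subset_cbox[of a b] by (intro closure_minimal) auto
        finally show ?thesis using integral_box_zero[OF h _ test] ab eq by auto
      qed (use eq in \<open>simp add: set_lebesgue_integral_def\<close>)
    qed
    have "compact (cbox a b)" by simp
    with h ab have "set_integrable lebesgue (cbox a b) h"
      unfolding L1_loc_def by blast
    then have "set_integrable lebesgue (box a b) h"
      by (rule set_integrable_subset) (auto simp: box_subset_cbox)
    then have "AE z in lebesgue. ?H z = 0"
      using integral_box_zero[OF h ab test]
      by (intro AE_zero_if_box_integrals_zero sub)
        (auto simp: set_integrable_def set_lebesgue_integral_def)
    then show ?thesis by eventually_elim (auto split: split_indicator_asm)
  qed
  \<comment> \<open>Smaller balls are covered instead of the disc itself: a box inside a ball of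
    radius below 1 has its closure inside the disc, whereas a box inside the disc may touch the unit
    circle.\<close>
  have "\<exists>D. countable D \<and> (\<forall>X\<in>D. \<exists>a b. X = box a b) \<and> \<Union>D = ball (0::complex) r" for r
  proof (rule open_countable_Union_open_box[OF open_ball[of 0 r]])
    fix D assume "countable D" "\<And>X. X \<in> D \<Longrightarrow> \<exists>a b. X = box a b" "\<Union>D = ball (0::complex) r"
    then show ?thesis by (intro exI[of _ D] conjI ballI)
  qed
  then have "\<exists>D. \<forall>r. countable (D r) \<and> (\<forall>X\<in>D r. \<exists>a b. X = box a b) \<and> \<Union>(D r) = ball (0::complex) r"
    by (intro choice allI)
  then obtain D where "\<forall>r. countable (D r) \<and> (\<forall>X\<in>D r. \<exists>a b. X = box a b) \<and> \<Union>(D r) = ball (0::complex) r" ..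
  then have D: "\<And>r. countable (D r)" "\<And>r X. X \<in> D r \<Longrightarrow> \<exists>a b. X = box a b"
    "\<And>r. \<Union>(D r) = ball (0::complex) r"
    by blast+
  have "AE z in lebesgue. z \<in> X \<longrightarrow> h z = 0" if X: "X \<in> D (1 - inverse (real (Suc m)))" for X m
  proof (cases "X = {}")
    case False
    obtain a b where ab: "X = box a b" using D(2)[OF X] by blast
    have "cbox a b = closure (box a b)" using False ab by (simp add: closure_box)
    also have "\<dots> \<subseteq> cball 0 (1 - inverse (real (Suc m)))"
      using X D(3) ab by (intro closure_minimal) (auto intro: ball_subset_cball[THEN subsetD])
    also have "\<dots> \<subseteq> disc" by (auto simp: subset_iff intro: le_less_trans)
    finally show ?thesis using box ab by simp
  qed simp
  then have "AE z in lebesgue. \<forall>m. \<forall>X\<in>D (1 - inverse (real (Suc m))). z \<in> X \<longrightarrow> h z = 0"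
    unfolding AE_all_countable AE_ball_countable[OF D(1)] by blast
  then have "AE z in lebesgue. z \<in> disc \<longrightarrow> h z = 0"
  proof (rule eventually_mono, intro impI)
    fix z assume *: "\<forall>m. \<forall>X\<in>D (1 - inverse (real (Suc m))). z \<in> X \<longrightarrow> h z = 0" and "z \<in> disc"
    then obtain m where "inverse (real (Suc m)) < 1 - norm z"
      using reals_Archimedean[of "1 - norm z"] by auto
    then have "z \<in> \<Union>(D (1 - inverse (real (Suc m))))" unfolding D by simp
    with * show "h z = 0" by blast
  qed
  then show ?thesis by (subst AE_restrict_space_iff) auto
qed

text \<open>The set where the functions differ is open, and a nonempty open set is not null.\<close>

lemma continuous_AE_eq:
  fixes f g :: "complex \<Rightarrow> complex"
  assumes "continuous_on disc f" "continuous_on disc g" "AE z in lebesgue_on disc. f z = g z" "z \<in> disc"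
  shows "f z = g z"
proof (rule ccontr)
  assume "f z \<noteq> g z"
  let ?S = "{z \<in> disc. f z - g z \<in> - {0}}"
  have "open ?S"
    using assms(1,2) continuous_open_preimage[of disc "\<lambda>z. f z - g z" "- {0}"]
    by (auto intro!: continuous_on_diff simp: vimage_def Int_def)
  moreover have "?S \<noteq> {}" using assms(4) \<open>f z \<noteq> g z\<close> by auto
  ultimately have "\<not> negligible ?S" by (rule open_not_negligible)
  moreover have "AE z in lebesgue. z \<in> disc \<longrightarrow> f z = g z"
    using assms(3) by (subst (asm) AE_restrict_space_iff) auto
  then have "AE z in lebesgue. z \<notin> ?S" by eventually_elim auto
  then have "?S \<in> null_sets lebesgue"
    using \<open>open ?S\<close> by (subst (asm) AE_iff_null_sets[symmetric]) auto
  ultimately show False by (simp add: negligible_iff_null_sets)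
qed

section \<open>The product rule for weak derivatives\<close>

lemma L1_loc_mult:
  assumes q: "continuous_on disc q" and u: "L1_loc u"
  shows "L1_loc (\<lambda>z. q z * u z)"
  unfolding L1_loc_def
proof (intro allI impI, elim conjE)
  fix K :: "complex set" assume K: "compact K" "K \<subseteq> disc"
  then have q': "continuous_on K q" using q continuous_on_subset by blast
  have int: "set_integrable lebesgue K u" using u K by (simp add: L1_loc_def)
  obtain B where B: "\<And>z. z \<in> K \<Longrightarrow> norm (q z) \<le> B"
    using compact_imp_bounded[OF compact_continuous_image[OF q' K(1)]]
    by (auto simp: bounded_iff)
  have "(\<lambda>z. indicator K z *\<^sub>R q z) \<in> borel_measurable lebesgue"
    using borel_measurable_continuous_on_indicator[OF _ q'] K
    by (simp add: measurable_completion borel_compact)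
  moreover have "(\<lambda>z. indicator K z *\<^sub>R u z) \<in> borel_measurable lebesgue"
    using int by (simp add: set_integrable_def borel_measurable_integrable)
  \<comment> \<open>Both factors carry the indicator because neither is known to be measurable on
    the whole plane.\<close>
  ultimately have "(\<lambda>z. (indicator K z *\<^sub>R q z) * (indicator K z *\<^sub>R u z)) \<in> borel_measurable lebesgue"
    by (rule borel_measurable_times)
  also have "(\<lambda>z. (indicator K z *\<^sub>R q z) * (indicator K z *\<^sub>R u z)) =
      (\<lambda>z. indicator K z *\<^sub>R (q z * u z))"
    by (auto simp: fun_eq_iff split: split_indicator)
  finally have m: "set_borel_measurable lebesgue K (\<lambda>z. q z * u z)"
    by (simp add: set_borel_measurable_def)
  show "set_integrable lebesgue K (\<lambda>z. q z * u z)"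
  proof (rule set_integrable_bound[OF _ m])
    show "set_integrable lebesgue K (\<lambda>z. of_real B * u z)" using int by simp
    show "AE z in lebesgue. z \<in> K \<longrightarrow> norm (q z * u z) \<le> norm (of_real B * u z)"
    proof (intro AE_I2 impI)
      fix z assume "z \<in> K"
      from B[OF this] show "norm (q z * u z) \<le> norm (of_real B * u z)"
        by (simp add: norm_mult mult_right_mono)
    qed
  qed
qed

lemma L1_loc_add: "L1_loc u \<Longrightarrow> L1_loc v \<Longrightarrow> L1_loc (\<lambda>z. u z + v z)"
  by (simp add: L1_loc_def)

lemma L1_loc_diff: "L1_loc u \<Longrightarrow> L1_loc v \<Longrightarrow> L1_loc (\<lambda>z. u z - v z)"
  by (simp add: L1_loc_def)

lemma L2_loc_continuous:
  assumes "continuous_on disc f"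
  shows "L2_loc f"
  unfolding L2_loc_def
proof (intro conjI allI impI; (elim conjE)?)
  show "f \<in> borel_measurable (lebesgue_on disc)"
    using assms by (rule continuous_imp_measurable_on_sets_lebesgue) simp
  fix K :: "complex set" assume K: "compact K" "K \<subseteq> disc"
  then have "continuous_on K (\<lambda>z. (cmod (f z))\<^sup>2)"
    using assms continuous_on_subset by (auto intro!: continuous_intros)
  with K have "set_integrable lborel K (\<lambda>z. (cmod (f z))\<^sup>2)"
    using borel_integrable_compact[of K "\<lambda>z. (cmod (f z))\<^sup>2"]
    by (simp add: set_integrable_def indicator_scaleR_eq_if)
  then show "set_integrable lebesgue K (\<lambda>z. (cmod (f z))\<^sup>2)"
    unfolding set_integrable_def
    by (subst integrable_completion) (auto dest: borel_measurable_integrable)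
qed

text \<open>This domination principle serves both products and sums, leaving only a pointwise
  majorant to be found.\<close>

lemma set_integrable_cmod_sq_bound:
  assumes f: "f \<in> borel_measurable (lebesgue_on disc)" and K: "compact K" "K \<subseteq> disc"
    and g: "set_integrable lebesgue K (g :: complex \<Rightarrow> real)"
    and le: "\<And>z. z \<in> K \<Longrightarrow> (cmod (f z))\<^sup>2 \<le> g z"
  shows "set_integrable lebesgue K (\<lambda>z. (cmod (f z))\<^sup>2)"
proof (rule set_integrable_bound[OF g])
  have "K \<in> sets lebesgue" using K by (simp add: borel_compact)
  then have "f \<in> borel_measurable (lebesgue_on K)"
    using measurable_restrict_mono[OF f] K by simp
  then have "(\<lambda>z. (cmod (f z))\<^sup>2) \<in> borel_measurable (lebesgue_on K)" by simp
  then show "set_borel_measurable lebesgue K (\<lambda>z. (cmod (f z))\<^sup>2)"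
    unfolding set_borel_measurable_def
    by (subst (asm) borel_measurable_restrict_space_iff) (use \<open>K \<in> sets lebesgue\<close> in auto)
  show "AE z in lebesgue. z \<in> K \<longrightarrow> norm ((cmod (f z))\<^sup>2) \<le> norm (g z)"
    by (intro AE_I2 impI) (use le in force)
qed

lemma L2_loc_mult:
  assumes q: "continuous_on disc q" and u: "L2_loc u"
  shows "L2_loc (\<lambda>z. q z * u z)"
proof -
  have m: "(\<lambda>z. q z * u z) \<in> borel_measurable (lebesgue_on disc)"
    using u continuous_imp_measurable_on_sets_lebesgue[OF q]
    by (intro borel_measurable_times) (auto simp: L2_loc_def)
  show ?thesis
    unfolding L2_loc_def
  proof (intro conjI allI impI m; elim conjE)
    fix K :: "complex set" assume K: "compact K" "K \<subseteq> disc"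
    then have q': "continuous_on K q" using q continuous_on_subset by blast
    obtain B where B: "\<And>z. z \<in> K \<Longrightarrow> norm (q z) \<le> B"
      using compact_imp_bounded[OF compact_continuous_image[OF q' K(1)]]
      by (auto simp: bounded_iff)
    show "set_integrable lebesgue K (\<lambda>z. (cmod (q z * u z))\<^sup>2)"
    proof (rule set_integrable_cmod_sq_bound[OF m K])
      show "set_integrable lebesgue K (\<lambda>z. B\<^sup>2 * (cmod (u z))\<^sup>2)"
        using u K by (simp add: L2_loc_def)
      show "(cmod (q z * u z))\<^sup>2 \<le> B\<^sup>2 * (cmod (u z))\<^sup>2" if "z \<in> K" for z
        using B[OF that] by (simp add: norm_mult power_mult_distrib mult_right_mono power_mono)
    qed
  qed
qed

lemma L2_loc_add:
  assumes "L2_loc u" "L2_loc v"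
  shows "L2_loc (\<lambda>z. u z + v z)"
proof -
  have m: "(\<lambda>z. u z + v z) \<in> borel_measurable (lebesgue_on disc)"
    using assms by (auto simp: L2_loc_def)
  show ?thesis
    unfolding L2_loc_def
  proof (intro conjI allI impI m; elim conjE)
    fix K :: "complex set" assume K: "compact K" "K \<subseteq> disc"
    show "set_integrable lebesgue K (\<lambda>z. (cmod (u z + v z))\<^sup>2)"
    proof (rule set_integrable_cmod_sq_bound[OF m K])
      show "set_integrable lebesgue K (\<lambda>z. 2 * (cmod (u z))\<^sup>2 + 2 * (cmod (v z))\<^sup>2)"
        using assms K by (simp add: L2_loc_def)
      show "(cmod (u z + v z))\<^sup>2 \<le> 2 * (cmod (u z))\<^sup>2 + 2 * (cmod (v z))\<^sup>2" for z
      proof -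
        have "(cmod (u z + v z))\<^sup>2 \<le> (cmod (u z) + cmod (v z))\<^sup>2"
          by (intro power_mono norm_triangle_ineq) simp
        also have "\<dots> \<le> 2 * (cmod (u z))\<^sup>2 + 2 * (cmod (v z))\<^sup>2"
          \<comment> \<open>Expanding the square of the difference gives 2xy <= x^2 + y^2.\<close>
          using zero_le_power2[of "cmod (u z) - cmod (v z)"]
          by (simp add: power2_eq_square algebra_simps)
        finally show ?thesis .
      qed
    qed
  qed
qed

text \<open>Local integrability says nothing near the unit circle; the compact support of
  \<open>\<psi>\<close> confines the integral to \<open>K\<close>.\<close>

lemma integrable_mult_compact_support:
  assumes "L1_loc u" "continuous_on disc \<psi>" "compact K" "K \<subseteq> disc" "\<And>z. z \<notin> K \<Longrightarrow> \<psi> z = 0"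
  shows "integrable (lebesgue_on disc) (\<lambda>z. u z * \<psi> z)"
proof -
  have "set_integrable lebesgue K (\<lambda>z. \<psi> z * u z)"
    using L1_loc_mult assms by (auto simp: L1_loc_def)
  moreover have "(\<lambda>z. indicator K z *\<^sub>R (\<psi> z * u z)) = (\<lambda>z. indicator disc z *\<^sub>R (u z * \<psi> z))"
    using assms by (auto simp: fun_eq_iff split: split_indicator)
  ultimately show ?thesis
    by (simp add: set_integrable_def integrable_restrict_space)
qed

text \<open>The direction is a parameter \<open>D\<close>, so that the rules below are proved once
  for both \<open>pdx\<close> and \<open>pdy\<close>.\<close>

definition weak_deriv ::
    "((complex \<Rightarrow> complex) \<Rightarrow> complex \<Rightarrow> complex) \<Rightarrow> (complex \<Rightarrow> complex) \<Rightarrow> (complex \<Rightarrow> complex) \<Rightarrow> bool" where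
  "weak_deriv D u g \<longleftrightarrow> L1_loc u \<and> L1_loc g \<and>
     (\<forall>\<phi>. test_fun \<phi> \<longrightarrow>
        (LINT z|lebesgue_on disc. u z * D \<phi> z) = - (LINT z|lebesgue_on disc. g z * \<phi> z))"

lemma has_weak_pderiv_iff_weak_deriv:
  "has_weak_pderiv 1 0 u g \<longleftrightarrow> weak_deriv pdx u g"
  "has_weak_pderiv 0 1 u g \<longleftrightarrow> weak_deriv pdy u g"
  by (simp_all add: has_weak_pderiv_def weak_deriv_def)

lemma test_fun_mult: "(\<And>k. Ck k q) \<Longrightarrow> test_fun \<phi> \<Longrightarrow> test_fun (\<lambda>z. q z * \<phi> z)"
  unfolding test_fun_def by (auto intro: Ck_mult)

text \<open>The complement of \<open>K\<close> is open, so near \<open>z\<close> the function is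
  identically zero. Thus differentiating a test function does not enlarge its support.\<close>

lemma pd_zero_outside:
  assumes "D \<in> {pdx, pdy}" "closed K" "\<And>z. z \<notin> K \<Longrightarrow> \<phi> z = 0" "z \<notin> K"
  shows "D \<phi> z = 0"
proof -
  have "(\<phi> has_derivative (\<lambda>_. 0)) (at z)"
    by (rule has_derivative_transform_within_open[of "\<lambda>_. 0" _ _ _ "- K"]) (use assms in auto)
  then show ?thesis using assms(1) by (auto simp: pdx_eq pdy_eq)
qed

lemma Ck_pd: "D \<in> {pdx, pdy} \<Longrightarrow> Ck (Suc k) f \<Longrightarrow> Ck k (D f)"
  by auto

lemma Ck_0_continuous: "Ck 0 f \<Longrightarrow> continuous_on S f"
  using continuous_on_subset by auto

lemma pd_mult:
  assumes "D \<in> {pdx, pdy}" "Ck 1 f" "Ck 1 g"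
  shows "D (\<lambda>z. f z * g z) z = f z * D g z + D f z * g z"
  using assms pdx_mult[of f z g] pdy_mult[of f z g] by auto

lemma integrable_mult_test_fun:
  assumes D: "D \<in> {pdx, pdy}" and \<phi>: "test_fun \<phi>" and u: "L1_loc u" and q: "continuous_on disc q"
  shows "integrable (lebesgue_on disc) (\<lambda>z. u z * (q z * \<phi> z))"
    "integrable (lebesgue_on disc) (\<lambda>z. u z * D \<phi> z)"
proof -
  obtain K where K: "compact K" "K \<subseteq> disc" "\<And>z. z \<notin> K \<Longrightarrow> \<phi> z = 0"
    and C: "\<And>k. Ck k \<phi>"
    using \<phi> by (auto simp: test_fun_def)
  show "integrable (lebesgue_on disc) (\<lambda>z. u z * (q z * \<phi> z))"
    using continuous_on_mult[OF q Ck_0_continuous[OF C]]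
    by (rule integrable_mult_compact_support[OF u _ K(1,2)]) (simp add: K)
  show "integrable (lebesgue_on disc) (\<lambda>z. u z * D \<phi> z)"
    using Ck_0_continuous[OF Ck_pd[OF D C]]
    by (rule integrable_mult_compact_support[OF u _ K(1,2)])
      (rule pd_zero_outside[OF D compact_imp_closed[OF K(1)] K(3)])
qed

text \<open>The factor \<open>q\<close> is moved onto the test function: \<open>q \<phi>\<close> is
  again a test function, and the classical product rule expresses \<open>q D\<phi>\<close> as
  \<open>D(q\<phi>) - (Dq)\<phi>\<close>. The weak derivative of \<open>u\<close> is then tested
  against \<open>q \<phi>\<close>.\<close>

lemma weak_deriv_mult:
  assumes D: "D \<in> {pdx, pdy}" and q: "\<And>k. Ck k q" and u: "weak_deriv D u g"
  shows "weak_deriv D (\<lambda>z. q z * u z) (\<lambda>z. D q z * u z + q z * g z)"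
proof -
  have cq: "continuous_on disc q" "continuous_on disc (D q)"
    by (rule Ck_0_continuous[OF q] Ck_0_continuous[OF Ck_pd[OF D q]])+
  have L: "L1_loc u" "L1_loc g" using u unfolding weak_deriv_def by blast+
  have "(LINT z|lebesgue_on disc. q z * u z * D \<phi> z) =
      - (LINT z|lebesgue_on disc. (D q z * u z + q z * g z) * \<phi> z)" if \<phi>: "test_fun \<phi>" for \<phi>
  proof -
    have q\<phi>: "test_fun (\<lambda>z. q z * \<phi> z)" using test_fun_mult[OF q \<phi>] .
    note int = integrable_mult_test_fun(2)[OF D q\<phi> L(1) cq(1)] integrable_mult_test_fun(1)[OF D \<phi> L(1) cq(2)]
      integrable_mult_test_fun(1)[OF D \<phi> L(2) cq(1)]
    have "D (\<lambda>z. q z * \<phi> z) z = q z * D \<phi> z + D q z * \<phi> z" for z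
      by (rule pd_mult[OF D]) (use q \<phi> in \<open>auto simp: test_fun_def\<close>)
    then have "(LINT z|lebesgue_on disc. q z * u z * D \<phi> z) =
        (LINT z|lebesgue_on disc. u z * D (\<lambda>z. q z * \<phi> z) z - u z * (D q z * \<phi> z))"
      by (simp add: algebra_simps)
    also have "\<dots> = (LINT z|lebesgue_on disc. u z * D (\<lambda>z. q z * \<phi> z) z) -
        (LINT z|lebesgue_on disc. u z * (D q z * \<phi> z))"
      using int by simp
    also have "(LINT z|lebesgue_on disc. u z * D (\<lambda>z. q z * \<phi> z) z) =
        - (LINT z|lebesgue_on disc. g z * (q z * \<phi> z))"
      using u q\<phi> by (simp add: weak_deriv_def)
    also have "- (LINT z|lebesgue_on disc. g z * (q z * \<phi> z)) -
        (LINT z|lebesgue_on disc. u z * (D q z * \<phi> z)) =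
        - (LINT z|lebesgue_on disc. u z * (D q z * \<phi> z) + g z * (q z * \<phi> z))"
      using int by simp
    finally show ?thesis by (simp add: algebra_simps)
  qed
  then show ?thesis
    unfolding weak_deriv_def
    using L1_loc_mult[OF cq(1) L(1)] L1_loc_add[OF L1_loc_mult[OF cq(2) L(1)] L1_loc_mult[OF cq(1) L(2)]]
    by simp
qed

lemma weak_deriv_add:
  assumes D: "D \<in> {pdx, pdy}" and u: "weak_deriv D u g" and v: "weak_deriv D v h"
  shows "weak_deriv D (\<lambda>z. u z + v z) (\<lambda>z. g z + h z)"
proof -
  have L: "L1_loc u" "L1_loc g" "L1_loc v" "L1_loc h" using u v unfolding weak_deriv_def by blast+
  have "(LINT z|lebesgue_on disc. (u z + v z) * D \<phi> z) =
      - (LINT z|lebesgue_on disc. (g z + h z) * \<phi> z)" if \<phi>: "test_fun \<phi>" for \<phi>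
    using u v \<phi> integrable_mult_test_fun[OF D \<phi> _ continuous_on_const[of _ 1]] L
    by (simp add: weak_deriv_def distrib_right)
  then show ?thesis
    unfolding weak_deriv_def using L1_loc_add[OF L(1,3)] L1_loc_add[OF L(2,4)] by simp
qed

text \<open>The difference of the two derivatives integrates to zero against every test function, so
  the fundamental lemma applies. Equality of \<open>u\<close> and \<open>v\<close> on the disc
  suffices, since all integrals are taken there.\<close>

lemma weak_deriv_unique:
  assumes D: "D \<in> {pdx, pdy}" and u: "weak_deriv D u g" and v: "weak_deriv D v h"
    and uv: "\<And>z. z \<in> disc \<Longrightarrow> u z = v z"
  shows "AE z in lebesgue_on disc. g z = h z"
proof -
  have L: "L1_loc g" "L1_loc h" using u v unfolding weak_deriv_def by blast+
  have "AE z in lebesgue_on disc. g z - h z = 0"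
  proof (rule fundamental_lemma)
    show "L1_loc (\<lambda>z. g z - h z)" using L by (rule L1_loc_diff)
    fix \<phi> assume \<phi>: "test_fun \<phi>"
    have "(LINT z|lebesgue_on disc. u z * D \<phi> z) = (LINT z|lebesgue_on disc. v z * D \<phi> z)"
      using uv by (intro Bochner_Integration.integral_cong) auto
    then show "(LINT z|lebesgue_on disc. (g z - h z) * \<phi> z) = 0"
      using u v \<phi> integrable_mult_test_fun(1)[OF D \<phi> _ continuous_on_const[of _ 1]] L
      by (simp add: weak_deriv_def left_diff_distrib)
  qed
  then show ?thesis by simp
qed

lemma weak_deriv_cong:
  assumes "weak_deriv D u g" "\<And>z. z \<in> disc \<Longrightarrow> u z = v z"
  shows "weak_deriv D v g"
proof -
  have "L1_loc v"
    unfolding L1_loc_def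
  proof (intro allI impI)
    fix K assume "compact K \<and> K \<subseteq> disc"
    moreover from this have "set_integrable lebesgue K u = set_integrable lebesgue K v"
      using assms(2) by (intro set_integrable_cong) auto
    ultimately show "set_integrable lebesgue K v"
      using assms(1) by (auto simp: weak_deriv_def L1_loc_def)
  qed
  moreover have "(LINT z|lebesgue_on disc. u z * D \<phi> z) = (LINT z|lebesgue_on disc. v z * D \<phi> z)" for \<phi>
    using assms(2) by (intro Bochner_Integration.integral_cong) auto
  ultimately show ?thesis using assms(1) by (simp add: weak_deriv_def)
qed

section \<open>The Beltrami operator as a linear, single-valued relation on the disc\<close>

lemma bel_op_weak_deriv:
  "bel_op \<mu> u f \<longleftrightarrow> continuous_on disc u \<and> continuous_on disc f \<and>
     (\<exists>ux uy. weak_deriv pdx u ux \<and> weak_deriv pdy u uy \<and> L2_loc ux \<and> L2_loc uy \<and>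
        (AE z in lebesgue_on disc.
           f z = (ux z + \<i> * uy z) / 2 - \<mu> z * ((ux z - \<i> * uy z) / 2)))"
  by (simp add: bel_op_def flip: has_weak_pderiv_iff_weak_deriv)

lemma bel_op_cong:
  assumes "bel_op \<mu> u f" "\<And>z. z \<in> disc \<Longrightarrow> u z = v z"
  shows "bel_op \<mu> v f"
proof -
  have "continuous_on disc u \<longleftrightarrow> continuous_on disc v"
    using assms(2) by (intro continuous_on_cong) auto
  then show ?thesis
    using assms unfolding bel_op_weak_deriv by (blast intro: weak_deriv_cong)
qed

text \<open>Uniqueness of weak derivatives makes the images agree almost everywhere, and continuity
  of \<open>f\<close> and \<open>g\<close> upgrades this to every point of the disc. This identifies
  the iterates in the main equivalence.\<close>

lemma bel_op_unique:
  assumes "bel_op \<mu> u f" "bel_op \<mu> v g" "\<And>z. z \<in> disc \<Longrightarrow> u z = v z" "z \<in> disc"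
  shows "f z = g z"
proof (rule continuous_AE_eq[OF _ _ _ assms(4)])
  show "continuous_on disc f" "continuous_on disc g"
    using assms by (auto simp: bel_op_def)
  obtain ux uy where u: "weak_deriv pdx u ux" "weak_deriv pdy u uy"
    "AE z in lebesgue_on disc. f z = (ux z + \<i> * uy z) / 2 - \<mu> z * ((ux z - \<i> * uy z) / 2)"
    using assms(1) unfolding bel_op_weak_deriv by blast
  obtain vx vy where v: "weak_deriv pdx v vx" "weak_deriv pdy v vy"
    "AE z in lebesgue_on disc. g z = (vx z + \<i> * vy z) / 2 - \<mu> z * ((vx z - \<i> * vy z) / 2)"
    using assms(2) unfolding bel_op_weak_deriv by blast
  have "AE z in lebesgue_on disc. ux z = vx z" "AE z in lebesgue_on disc. uy z = vy z"
    using weak_deriv_unique[OF _ u(1) v(1) assms(3)] weak_deriv_unique[OF _ u(2) v(2) assms(3)]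
    by auto
  with u(3) v(3) show "AE z in lebesgue_on disc. f z = g z"
    by eventually_elim simp
qed

lemma bel_op_add:
  assumes "bel_op \<mu> u f" "bel_op \<mu> v g"
  shows "bel_op \<mu> (\<lambda>z. u z + v z) (\<lambda>z. f z + g z)"
proof -
  obtain ux uy where u: "weak_deriv pdx u ux" "weak_deriv pdy u uy" "L2_loc ux" "L2_loc uy"
    "AE z in lebesgue_on disc. f z = (ux z + \<i> * uy z) / 2 - \<mu> z * ((ux z - \<i> * uy z) / 2)"
    using assms(1) unfolding bel_op_weak_deriv by blast
  obtain vx vy where v: "weak_deriv pdx v vx" "weak_deriv pdy v vy" "L2_loc vx" "L2_loc vy"
    "AE z in lebesgue_on disc. g z = (vx z + \<i> * vy z) / 2 - \<mu> z * ((vx z - \<i> * vy z) / 2)"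
    using assms(2) unfolding bel_op_weak_deriv by blast
  show ?thesis
    unfolding bel_op_weak_deriv
  proof (intro conjI exI)
    show "continuous_on disc (\<lambda>z. u z + v z)" "continuous_on disc (\<lambda>z. f z + g z)"
      using assms by (auto simp: bel_op_def intro!: continuous_intros)
    show "weak_deriv pdx (\<lambda>z. u z + v z) (\<lambda>z. ux z + vx z)"
      "weak_deriv pdy (\<lambda>z. u z + v z) (\<lambda>z. uy z + vy z)"
      using u v by (simp_all add: weak_deriv_add)
    show "L2_loc (\<lambda>z. ux z + vx z)" "L2_loc (\<lambda>z. uy z + vy z)"
      using u v by (simp_all add: L2_loc_add)
    show "AE z in lebesgue_on disc. f z + g z =
        (ux z + vx z + \<i> * (uy z + vy z)) / 2 - \<mu> z * ((ux z + vx z - \<i> * (uy z + vy z)) / 2)"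
      using u(5) v(5) by eventually_elim (simp add: field_simps)
  qed
qed

lemma bel_op_zero: "bel_op \<mu> (\<lambda>_. 0) (\<lambda>_. 0)"
proof -
  have "weak_deriv D (\<lambda>_. 0) (\<lambda>_. 0)" for D
    by (simp add: weak_deriv_def L1_loc_def set_integrable_def)
  moreover have "L2_loc (\<lambda>_. 0)" by (rule L2_loc_continuous) simp
  ultimately show ?thesis
    unfolding bel_op_weak_deriv by (intro conjI exI[of _ "\<lambda>_. 0"]) auto
qed

lemma bel_op_sum:
  "(\<And>i. i \<in> A \<Longrightarrow> bel_op \<mu> (u i) (f i)) \<Longrightarrow> bel_op \<mu> (\<lambda>z. \<Sum>i\<in>A. u i z) (\<lambda>z. \<Sum>i\<in>A. f i z)"
  \<comment> \<open>An infinite index set yields the zero sum and is settled by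
    \<open>bel_op_zero\<close>, like the empty one.\<close>
  by (induction A rule: infinite_finite_induct) (auto intro: bel_op_add bel_op_zero)

text \<open>The factor is antiholomorphic: its z-derivative vanishes, so \<open>\<mu>\<close> never
  meets it, and its derivative in \<open>cnj z\<close> is the usual one for powers. The remaining
  term is the factor times the image of \<open>u\<close>, which is zero.\<close>

lemma bel_op_cnj_power_mult:
  assumes "solves_beltrami \<mu> u"
  shows "bel_op \<mu> (\<lambda>z. a * cnj z ^ m * u z) (\<lambda>z. a * of_nat m * cnj z ^ (m - 1) * u z)"
proof -
  let ?q = "\<lambda>z. a * cnj z ^ m" and ?q' = "\<lambda>z. a * of_nat m * cnj z ^ (m - 1)"
  have u: "continuous_on disc u" using assms by (simp add: solves_beltrami_def bel_op_def)
  obtain ux uy where uxy: "weak_deriv pdx u ux" "weak_deriv pdy u uy" "L2_loc ux" "L2_loc uy"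
    "AE z in lebesgue_on disc. 0 = (ux z + \<i> * uy z) / 2 - \<mu> z * ((ux z - \<i> * uy z) / 2)"
    using assms unfolding solves_beltrami_def bel_op_weak_deriv by blast
  have pd: "pdx ?q = ?q'" "pdy ?q = (\<lambda>z. - \<i> * ?q' z)"
    by (intro ext, simp add: pdx_cnj_power pdy_cnj_power)+
  show ?thesis
    unfolding bel_op_weak_deriv
  proof (intro conjI exI)
    show "continuous_on disc (\<lambda>z. ?q z * u z)" "continuous_on disc (\<lambda>z. ?q' z * u z)"
      by (intro continuous_intros u)+
    show "weak_deriv pdx (\<lambda>z. ?q z * u z) (\<lambda>z. ?q' z * u z + ?q z * ux z)"
      using weak_deriv_mult[of pdx ?q u ux] uxy by (simp add: pd Ck_cnj_power)
    show "weak_deriv pdy (\<lambda>z. ?q z * u z) (\<lambda>z. (- \<i> * ?q' z) * u z + ?q z * uy z)"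
      using weak_deriv_mult[of pdy ?q u uy] uxy by (simp only: pd Ck_cnj_power) simp
    have "continuous_on disc ?q" "continuous_on disc (\<lambda>z. ?q' z * u z)"
      "continuous_on disc (\<lambda>z. (- \<i> * ?q' z) * u z)"
      by (intro continuous_intros u)+
    note cont = this
    show "L2_loc (\<lambda>z. ?q' z * u z + ?q z * ux z)"
      by (rule L2_loc_add[OF L2_loc_continuous L2_loc_mult]) (fact cont uxy)+
    show "L2_loc (\<lambda>z. (- \<i> * ?q' z) * u z + ?q z * uy z)"
      by (rule L2_loc_add[OF L2_loc_continuous L2_loc_mult]) (fact cont uxy)+
    show "AE z in lebesgue_on disc. ?q' z * u z =
        (?q' z * u z + ?q z * ux z + \<i> * ((- \<i> * ?q' z) * u z + ?q z * uy z)) / 2 -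
        \<mu> z * ((?q' z * u z + ?q z * ux z - \<i> * ((- \<i> * ?q' z) * u z + ?q z * uy z)) / 2)"
      using uxy(5)
    proof eventually_elim
      case (elim z)
      \<comment> \<open>The two contributions of \<open>?q'\<close> add up in the first bracket and
        cancel in the bracket multiplied by \<open>\<mu>\<close>.\<close>
      have "(?q' z * u z + ?q z * ux z + \<i> * ((- \<i> * ?q' z) * u z + ?q z * uy z)) / 2 -
          \<mu> z * ((?q' z * u z + ?q z * ux z - \<i> * ((- \<i> * ?q' z) * u z + ?q z * uy z)) / 2) =
        ?q' z * u z + ?q z * ((ux z + \<i> * uy z) / 2 - \<mu> z * ((ux z - \<i> * uy z) / 2))"
        by (simp add: field_simps)
      then show ?case using elim by simp
    qed
  qed
qed

section \<open>Circle means\<close>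

lemma circle_sup_cong:
  assumes "\<And>z. z \<in> disc \<Longrightarrow> u z = v z"
  shows "circle_sup p u = circle_sup p v"
  unfolding circle_sup_def using assms
  by (intro SUP_cong nn_integral_cong refl) simp

lemma circle_measurable:
  assumes "continuous_on disc u" "p > 0" "0 < r" "r < 1"
  shows "(\<lambda>\<theta>. ennreal (cmod (u (rcis r \<theta>)) powr p)) \<in> borel_measurable lborel"
proof -
  have "continuous_on UNIV (\<lambda>\<theta>. rcis r \<theta>)"
    unfolding rcis_def cis_conv_exp by (intro continuous_intros)
  then have "continuous_on UNIV (\<lambda>\<theta>. u (rcis r \<theta>))"
    using assms by (intro continuous_on_compose2[OF assms(1)]) auto
  then have "(\<lambda>\<theta>. u (rcis r \<theta>)) \<in> borel_measurable borel"
    by (rule borel_measurable_continuous_onI)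
  then show ?thesis by measurable
qed

lemma circle_sup_finite_mult:
  assumes u: "continuous_on disc u" "circle_sup p u < \<infinity>" and p: "p > 0"
    and q: "\<And>z. z \<in> disc \<Longrightarrow> cmod (q z) \<le> B"
  shows "circle_sup p (\<lambda>z. q z * u z) < \<infinity>"
proof -
  \<comment> \<open>The centre belongs to the disc, so the bound on \<open>q\<close> there forces
    \<open>B\<close> to be nonnegative, as splitting the power of a product requires.\<close>
  have B: "0 \<le> B" using order_trans[OF norm_ge_zero q[of 0]] by simp
  have "circle_sup p (\<lambda>z. q z * u z) \<le> ennreal (B powr p) * circle_sup p u"
    unfolding circle_sup_def
  proof (rule SUP_least)
    fix r :: real assume r: "r \<in> {0<..<1}"
    have "(\<integral>\<^sup>+\<theta>\<in>{0..2 * pi}. ennreal (cmod (q (rcis r \<theta>) * u (rcis r \<theta>)) powr p) \<partial>lborel) \<le>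
        (\<integral>\<^sup>+\<theta>. ennreal (B powr p) * (ennreal (cmod (u (rcis r \<theta>)) powr p) * indicator {0..2 * pi} \<theta>) \<partial>lborel)"
    proof (intro nn_integral_mono)
      fix \<theta>
      have "cmod (q (rcis r \<theta>) * u (rcis r \<theta>)) powr p \<le> (B * cmod (u (rcis r \<theta>))) powr p"
        using r p q[of "rcis r \<theta>"] by (intro powr_mono2) (auto simp: norm_mult mult_right_mono)
      also have "\<dots> = B powr p * cmod (u (rcis r \<theta>)) powr p"
        using B by (simp add: powr_mult)
      finally show "ennreal (cmod (q (rcis r \<theta>) * u (rcis r \<theta>)) powr p) * indicator {0..2 * pi} \<theta>
          \<le> ennreal (B powr p) * (ennreal (cmod (u (rcis r \<theta>)) powr p) * indicator {0..2 * pi} \<theta>)"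
        by (auto simp: ennreal_mult[symmetric] ennreal_leI split: split_indicator)
    qed
    also have "\<dots> = ennreal (B powr p) *
        (\<integral>\<^sup>+\<theta>\<in>{0..2 * pi}. ennreal (cmod (u (rcis r \<theta>)) powr p) \<partial>lborel)"
      using circle_measurable[OF u(1) p, of r] r by (intro nn_integral_cmult) auto
    also have "\<dots> \<le> ennreal (B powr p) * (SUP r\<in>{0<..<1}.
        \<integral>\<^sup>+\<theta>\<in>{0..2 * pi}. ennreal (cmod (u (rcis r \<theta>)) powr p) \<partial>lborel)"
      using r by (intro mult_left_mono SUP_upper) auto
    finally show "(\<integral>\<^sup>+\<theta>\<in>{0..2 * pi}. ennreal (cmod (q (rcis r \<theta>) * u (rcis r \<theta>)) powr p) \<partial>lborel) \<le>
        ennreal (B powr p) * (SUP r\<in>{0<..<1}.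
          \<integral>\<^sup>+\<theta>\<in>{0..2 * pi}. ennreal (cmod (u (rcis r \<theta>)) powr p) \<partial>lborel)" .
  qed
  also have "\<dots> < \<infinity>" using u(2) by (simp add: ennreal_mult_less_top)
  finally show ?thesis .
qed

text \<open>The sum is at most twice the larger summand. This crude bound treats all positive
  exponents alike, with no distinction between p < 1 and p >= 1.\<close>

lemma powr_add_le:
  fixes x y p :: real
  assumes "0 \<le> x" "0 \<le> y" "0 < p"
  shows "(x + y) powr p \<le> (2 * x) powr p + (2 * y) powr p"
proof (cases "x \<le> y")
  case True
  then have "(x + y) powr p \<le> (2 * y) powr p" using assms by (intro powr_mono2) auto
  then show ?thesis by (simp add: add_increasing)
next
  case False
  then have "(x + y) powr p \<le> (2 * x) powr p" using assms by (intro powr_mono2) auto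
  then show ?thesis by (simp add: add_increasing2)
qed

lemma circle_sup_finite_add:
  assumes u: "continuous_on disc u" "circle_sup p u < \<infinity>"
    and v: "continuous_on disc v" "circle_sup p v < \<infinity>" and p: "p > 0"
  shows "circle_sup p (\<lambda>z. u z + v z) < \<infinity>"
proof -
  let ?I = "\<lambda>w r. \<integral>\<^sup>+\<theta>\<in>{0..2 * pi}. ennreal (cmod (2 * w (rcis r \<theta>)) powr p) \<partial>lborel"
  have fin: "circle_sup p (\<lambda>z. 2 * u z) < \<infinity>" "circle_sup p (\<lambda>z. 2 * v z) < \<infinity>"
    using circle_sup_finite_mult[OF u p, of "\<lambda>_. 2" 2] circle_sup_finite_mult[OF v p, of "\<lambda>_. 2" 2]
    by simp_all
  have cont: "continuous_on disc (\<lambda>z. 2 * u z)" "continuous_on disc (\<lambda>z. 2 * v z)"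
    using u v by (auto intro: continuous_intros)
  have "circle_sup p (\<lambda>z. u z + v z) \<le> circle_sup p (\<lambda>z. 2 * u z) + circle_sup p (\<lambda>z. 2 * v z)"
    unfolding circle_sup_def[of p "\<lambda>z. u z + v z"]
  proof (rule SUP_least)
    fix r :: real assume r: "r \<in> {0<..<1}"
    have "(\<integral>\<^sup>+\<theta>\<in>{0..2 * pi}. ennreal (cmod (u (rcis r \<theta>) + v (rcis r \<theta>)) powr p) \<partial>lborel) \<le>
        (\<integral>\<^sup>+\<theta>. ennreal (cmod (2 * u (rcis r \<theta>)) powr p) * indicator {0..2 * pi} \<theta> +
          ennreal (cmod (2 * v (rcis r \<theta>)) powr p) * indicator {0..2 * pi} \<theta> \<partial>lborel)"
    proof (intro nn_integral_mono)
      fix \<theta>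
      have "cmod (u (rcis r \<theta>) + v (rcis r \<theta>)) powr p \<le>
          (cmod (u (rcis r \<theta>)) + cmod (v (rcis r \<theta>))) powr p"
        using p by (intro powr_mono2 norm_triangle_ineq) auto
      also have "\<dots> \<le> cmod (2 * u (rcis r \<theta>)) powr p + cmod (2 * v (rcis r \<theta>)) powr p"
        using powr_add_le[OF norm_ge_zero norm_ge_zero p] by (simp add: norm_mult)
      finally show "ennreal (cmod (u (rcis r \<theta>) + v (rcis r \<theta>)) powr p) * indicator {0..2 * pi} \<theta>
          \<le> ennreal (cmod (2 * u (rcis r \<theta>)) powr p) * indicator {0..2 * pi} \<theta> +
          ennreal (cmod (2 * v (rcis r \<theta>)) powr p) * indicator {0..2 * pi} \<theta>"
        by (auto simp: ennreal_plus[symmetric] ennreal_leI simp del: ennreal_plus split: split_indicator)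
    qed
    also have "\<dots> = ?I u r + ?I v r"
      using circle_measurable[OF cont(1) p, of r] circle_measurable[OF cont(2) p, of r] r
      by (intro nn_integral_add) auto
    also have "\<dots> \<le> circle_sup p (\<lambda>z. 2 * u z) + circle_sup p (\<lambda>z. 2 * v z)"
      unfolding circle_sup_def using r by (intro add_mono SUP_upper) auto
    finally show "(\<integral>\<^sup>+\<theta>\<in>{0..2 * pi}. ennreal (cmod (u (rcis r \<theta>) + v (rcis r \<theta>)) powr p) \<partial>lborel) \<le>
        circle_sup p (\<lambda>z. 2 * u z) + circle_sup p (\<lambda>z. 2 * v z)" .
  qed
  also have "\<dots> < \<infinity>" using fin by simp
  finally show ?thesis .
qed

lemma circle_sup_finite_sum:
  assumes "p > 0" "finite A"
    and "\<And>i. i \<in> A \<Longrightarrow> continuous_on disc (u i)" "\<And>i. i \<in> A \<Longrightarrow> circle_sup p (u i) < \<infinity>"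
  shows "circle_sup p (\<lambda>z. \<Sum>i\<in>A. u i z) < \<infinity>"
  using assms(2-)
proof (induction A)
  case empty
  then show ?case using assms(1) by (simp add: circle_sup_def)
next
  case (insert i A)
  then have "circle_sup p (\<lambda>z. u i z + (\<Sum>i\<in>A. u i z)) < \<infinity>"
    by (intro circle_sup_finite_add assms(1)) (auto intro!: continuous_intros)
  then show ?case using insert by simp
qed

text \<open>Powers of \<open>cnj z\<close> have modulus at most 1 on the disc, so the multiplier is
  bounded by \<open>cmod a\<close> whatever \<open>m\<close> is.\<close>

lemma circle_sup_finite_cnj_power:
  assumes "continuous_on disc u" "circle_sup p u < \<infinity>" "p > 0"
  shows "circle_sup p (\<lambda>z. a * cnj z ^ m * u z) < \<infinity>"
proof (rule circle_sup_finite_mult[OF assms])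
  fix z assume "z \<in> disc"
  then have "cmod z ^ m \<le> 1" by (intro power_le_one) auto
  then show "cmod (a * cnj z ^ m) \<le> cmod a"
    by (simp add: norm_mult norm_power mult_left_le)
qed

theorem theorem3p11:
  fixes p c :: real and n :: nat and \<mu> w :: "complex \<Rightarrow> complex"
    and wk :: "nat \<Rightarrow> complex \<Rightarrow> complex"
  assumes "p > 0" and "n \<ge> 1"
    and "\<mu> \<in> W_inf (n - 1)"
    and "0 < c" and "c < 1" and "W_inf_norm (n - 1) \<mu> \<le> ereal c"
    and "\<And>k. k < n \<Longrightarrow> solves_beltrami \<mu> (wk k)"
    and "\<And>z. z \<in> disc \<Longrightarrow> w z = (\<Sum>k<n. (cnj z) ^ k * wk k z)"
  shows "w \<in> Hn_Bel n p \<mu> \<longleftrightarrow> (\<forall>k<n. wk k \<in> H_Bel p \<mu>)"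
proof -
  note p = assms(1) and beltrami = assms(7) and w = assms(8)
  \<comment> \<open>The coefficient is the falling factorial k(k-1)...(k-j+1). Truncated subtraction
    makes it 0 for \<open>k < j\<close>, so \<open>G j\<close> can sum over all \<open>k < n\<close>
    without a side condition, and the truncated exponent \<open>k - j\<close> does no harm.\<close>
  define a :: "nat \<Rightarrow> nat \<Rightarrow> complex" where "a j k = (\<Prod>i<j. of_nat (k - i))" for j k
  define G where "G j z = (\<Sum>k<n. a j k * cnj z ^ (k - j) * wk k z)" for j z
  have a_zero: "a j k = 0" if "k < j" for j k
    unfolding a_def by (rule prod_zero) (use that in auto)
  have cont: "continuous_on disc (wk k)" if "k < n" for k
    using beltrami[OF that] by (simp add: solves_beltrami_def bel_op_def)
  have G_step: "bel_op \<mu> (G j) (G (Suc j))" for j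
  proof -
    have "bel_op \<mu> (\<lambda>z. a j k * cnj z ^ (k - j) * wk k z)
        (\<lambda>z. a (Suc j) k * cnj z ^ (k - Suc j) * wk k z)" if "k < n" for k
      \<comment> \<open>Differentiating the power brings down \<open>k - j\<close>, exactly the next
        factor of the falling factorial.\<close>
      using bel_op_cnj_power_mult[OF beltrami[OF that], of "a j k" "k - j"]
      by (simp add: a_def)
    then show ?thesis
      unfolding G_def[abs_def] by (intro bel_op_sum) auto
  qed
  have G_0: "G 0 z = w z" if "z \<in> disc" for z
    using w[OF that] by (simp add: G_def a_def)
  show ?thesis
  proof
    assume "w \<in> Hn_Bel n p \<mu>"
    then obtain g where g: "g 0 = w" "\<And>k. k < n \<Longrightarrow> bel_op \<mu> (g k) (g (Suc k))"
      "(\<Sum>k<n. circle_sup p (g k)) < \<infinity>"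
      unfolding Hn_Bel_def by blast
    \<comment> \<open>Any chain of iterates of \<open>w\<close> coincides on the disc with the
      explicit one, by uniqueness at each step.\<close>
    have g_eq: "g j z = G j z" if "j \<le> n" "z \<in> disc" for j z
      using that
    proof (induction j arbitrary: z)
      case 0
      then show ?case using g(1) G_0 by simp
    next
      case (Suc j)
      show ?case
        by (rule bel_op_unique[OF g(2) G_step]) (use Suc in auto)
    qed
    have G_fin: "circle_sup p (G j) < \<infinity>" if "j < n" for j
    proof -
      have "circle_sup p (G j) = circle_sup p (g j)"
        using g_eq[of j] that by (intro circle_sup_cong) simp
      also have "\<dots> \<le> (\<Sum>k<n. circle_sup p (g k))"
        using that by (intro member_le_sum) auto
      finally show ?thesis using g(3) by (rule le_less_trans)
    qed
    have "circle_sup p (wk k) < \<infinity>" if "k < n" for k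
      using that
    \<comment> \<open>Descending induction on \<open>k\<close>: the bounds for all larger indices
      below \<open>n\<close> are at hand.\<close>
    proof (induction "n - k" arbitrary: k rule: less_induct)
      case (less k)
      let ?T = "\<lambda>j z. a k j * cnj z ^ (j - k) * wk j z"
      have "a k k \<noteq> 0" by (simp add: a_def)
      \<comment> \<open>Row \<open>k\<close> of the triangular system is solved for its diagonal
        term, whose coefficient \<open>a k k\<close> is k factorial; terms with smaller index drop
        out. The subtraction is written as a product with -1 to fit the rules for multipliers and
        sums.\<close>
      have "wk k z = inverse (a k k) * (G k z + (- 1) * (\<Sum>j\<in>{k<..<n}. ?T j z))" for z
      proof -
        have "G k z = (\<Sum>j\<in>insert k {k<..<n}. ?T j z)"
          unfolding G_def using less.prems
          by (intro sum.mono_neutral_right) (auto simp: a_zero)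
        then show ?thesis using \<open>a k k \<noteq> 0\<close> by simp
      qed
      then have eq: "wk k = (\<lambda>z. inverse (a k k) * (G k z + (- 1) * (\<Sum>j\<in>{k<..<n}. ?T j z)))"
        by blast
      have G_cont: "continuous_on disc (G k)" using G_step by (simp add: bel_op_def)
      have T_cont: "continuous_on disc (\<lambda>z. \<Sum>j\<in>{k<..<n}. ?T j z)"
        using cont by (intro continuous_intros) auto
      have "circle_sup p (\<lambda>z. \<Sum>j\<in>{k<..<n}. ?T j z) < \<infinity>"
        using less cont
        by (intro circle_sup_finite_sum circle_sup_finite_cnj_power p continuous_intros) auto
      then have "circle_sup p (\<lambda>z. (- 1) * (\<Sum>j\<in>{k<..<n}. ?T j z)) < \<infinity>"
        by (intro circle_sup_finite_mult[where B = 1] T_cont p) auto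
      then have "circle_sup p (\<lambda>z. G k z + (- 1) * (\<Sum>j\<in>{k<..<n}. ?T j z)) < \<infinity>"
        using less.prems by (intro circle_sup_finite_add G_cont G_fin p continuous_intros T_cont)
      then have "circle_sup p (\<lambda>z. inverse (a k k) * (G k z + (- 1) * (\<Sum>j\<in>{k<..<n}. ?T j z))) < \<infinity>"
        by (intro circle_sup_finite_mult[where B = "cmod (inverse (a k k))"] p continuous_intros G_cont T_cont) auto
      then show ?case by (subst eq)
    qed
    then show "\<forall>k<n. wk k \<in> H_Bel p \<mu>" using beltrami by (simp add: H_Bel_def)
  next
    assume "\<forall>k<n. wk k \<in> H_Bel p \<mu>"
    then have fin: "circle_sup p (wk k) < \<infinity>" if "k < n" for k
      using that by (simp add: H_Bel_def)
    have G_fin: "circle_sup p (G j) < \<infinity>" for j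
      unfolding G_def[abs_def] using fin cont
      by (intro circle_sup_finite_sum circle_sup_finite_cnj_power p continuous_intros) auto
    \<comment> \<open>Membership demands \<open>g 0 = w\<close> as functions on the plane, but
      \<open>G 0\<close> and \<open>w\<close> are known to agree only on the disc; hence the
      separate case \<open>j = 0\<close>.\<close>
    define g where "g j = (if j = 0 then w else G j)" for j
    have g_eq: "g j z = G j z" if "z \<in> disc" for j z
      using G_0[OF that] by (simp add: g_def)
    have "bel_op \<mu> (g k) (g (Suc k))" for k
      using bel_op_cong[OF G_step[of k], of "g k"] g_eq by (simp add: g_def[of "Suc k"])
    moreover have "g n z = 0" if "z \<in> disc" for z
      \<comment> \<open>Every index in the sum is below \<open>n\<close>, so each coefficient
        \<open>a n k\<close> contains the factor 0.\<close>
      using g_eq[OF that] by (simp add: G_def a_zero)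
    moreover have "circle_sup p (g k) < \<infinity>" for k
      using G_fin[of k] circle_sup_cong[of "g k" "G k" p] g_eq by simp
    then have "(\<Sum>k<n. circle_sup p (g k)) < \<infinity>"
      by simp
    moreover have "g 0 = w" by (simp add: g_def)
    ultimately show "w \<in> Hn_Bel n p \<mu>"
      unfolding Hn_Bel_def by blast
  qed
qed

end
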